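(* Let $X$ be a $K$-valued random variable that is not almost surely $0$. Then $X$ is $K$-Gaussian if and only if there exists $n\in\mathbb{Z}$ such that $$\mathbb{P}\{X\in dx\}=q^{-n}\Phi(q^{-n}|x|)\,\lambda(dx)=\frac{1}{|\rho^{-n}|}\mathbf{1}_{\rho^{-n}D}(x)\,\lambda(dx),$$ or, equivalently, $\mathbb{E}[\chi(\xi X)]=\Phi(q^{n}|\xi|)$ for all $\xi\in K$.
   Context: $K$ is a local field, i.e. a locally compact, non-discrete, totally disconnected topological field. It carries an absolute value $x\mapsto|x|$ with $|x|=0\iff x=0$, $|xy|=|x||y|$, $|x+y|\le|x|\vee|y|$, taking values in $\{q^k:k\in\mathbb{Z}\}\cup\{0\}$ for some $q=p^c$ ($p$ prime, $c\ge1$) and inducing the topology of $K$. Let $D=\{x\in K:|x|\le1\}$ and fix $\rho\in K$ with $|\rho|=q^{-1}$. $\lambda$ is the Haar measure on $(K,+)$ normalised by $\lambda(D)=1$. $\chi$ is a character of $(K,+)$ with $\chi(D)=\{1\}$ and $\chi(\rho^{-1}D)\neq\{1\}$. $\Phi:[0,\infty)\to\{0,1\}$ is the indicator function of $[0,1]$. $K^2$ is normed by $|(x_1,x_2)|=|x_1|\vee|x_2|$; a pair of vectors $v_1,v_2\in K^2$ is orthonormal if $|v_1|=|v_2|=1$ and $|\alpha_1v_1+\alpha_2v_2|=|\alpha_1|\vee|\alpha_2|$ for all $\alpha_1,\alpha_2\in K$. A $K$-valued random variable $X$ is called $K$-Gaussian if whenever $X_1,X_2$ are two independent copies of $X$ and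 $(\alpha_{11},\alpha_{12}),(\alpha_{21},\alpha_{22})\in K^2$ are orthonormal, the pair $(\alpha_{11}X_1+\alpha_{12}X_2,\alpha_{21}X_1+\alpha_{22}X_2)$ has the same law as $(X_1,X_2)$.
   Formalization: The formal statement also assumes q is the number of elements of the residue field D/ρD (the standard normalisation), without which the density need not have mass 1 (e.g. Q_2 with |2|=1/4); the rewritten density with 1/|ρ^{-n}| and the indicator of ρ^{-n}D is not stated. *)

theory Defs
  imports "HOL-Probability.Probability" "HOL-Computational_Algebra.Primes"
begin

definition Ktop :: "('k::field \<Rightarrow> real) \<Rightarrow> 'k topology" where
  "Ktop absv = Metric_space.mtopology UNIV (\<lambda>x y. absv (x - y))"

definition Kborel :: "('k::field \<Rightarrow> real) \<Rightarrow> 'k measure" where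
  "Kborel absv = sigma UNIV {U. openin (Ktop absv) U}"

definition Dball :: "('k::field \<Rightarrow> real) \<Rightarrow> 'k set" where
  "Dball absv = {x. absv x \<le> 1}"

text \<open>Local field data: ultrametric absolute value with values in
  {q^k : k in Z} u {0}, q = p^c, |rho| = 1/q, D compact (local compactness),
  and q is the cardinality of the residue field D / rho D (normalised absolute value).\<close>
definition local_field_data :: "('k::field \<Rightarrow> real) \<Rightarrow> nat \<Rightarrow> 'k \<Rightarrow> bool" where
  "local_field_data absv q \<rho> \<longleftrightarrow>
     (\<forall>x. absv x = 0 \<longleftrightarrow> x = 0) \<and>
     (\<forall>x y. absv (x * y) = absv x * absv y) \<and>
     (\<forall>x y. absv (x + y) \<le> max (absv x) (absv y)) \<and>
     (\<exists>p c. prime p \<and> c \<ge> 1 \<and> q = p ^ c) \<and>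
     (\<forall>x. x \<noteq> 0 \<longrightarrow> (\<exists>k::int. absv x = real q powi k)) \<and>
     absv \<rho> = 1 / real q \<and>
     compactin (Ktop absv) (Dball absv) \<and>
     card {{a + \<rho> * y | y. y \<in> Dball absv} | a. a \<in> Dball absv} = q"

definition normalized_haar :: "('k::field \<Rightarrow> real) \<Rightarrow> 'k measure \<Rightarrow> bool" where
  "normalized_haar absv lam \<longleftrightarrow>
     sets lam = sets (Kborel absv) \<and>
     (\<forall>a. \<forall>A \<in> sets lam. emeasure lam ((\<lambda>x. a + x) ` A) = emeasure lam A) \<and>
     emeasure lam (Dball absv) = 1"

definition is_character :: "('k::field \<Rightarrow> real) \<Rightarrow> ('k \<Rightarrow> complex) \<Rightarrow> bool" where
  "is_character absv chr \<longleftrightarrow>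
     (\<forall>x y. chr (x + y) = chr x * chr y) \<and> (\<forall>x. norm (chr x) = 1) \<and>
     continuous_map (Ktop absv) euclidean chr"

definition Phi :: "real \<Rightarrow> real" where
  "Phi t = (if 0 \<le> t \<and> t \<le> 1 then 1 else 0)"

definition norm2 :: "('k::field \<Rightarrow> real) \<Rightarrow> 'k \<times> 'k \<Rightarrow> real" where
  "norm2 absv v = max (absv (fst v)) (absv (snd v))"

definition orthonormal2 :: "('k::field \<Rightarrow> real) \<Rightarrow> 'k \<times> 'k \<Rightarrow> 'k \<times> 'k \<Rightarrow> bool" where
  "orthonormal2 absv v1 v2 \<longleftrightarrow>
     norm2 absv v1 = 1 \<and> norm2 absv v2 = 1 \<and>
     (\<forall>a1 a2. norm2 absv (a1 * fst v1 + a2 * fst v2, a1 * snd v1 + a2 * snd v2)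
              = max (absv a1) (absv a2))"

text \<open>K-Gaussian: for two independent copies X1, X2 of X (joint law mu x mu,
  mu the law of X) and orthonormal rows (a11,a12), (a21,a22), the pair
  (a11 X1 + a12 X2, a21 X1 + a22 X2) has the same law as (X1, X2).\<close>
definition K_gaussian :: "('k::field \<Rightarrow> real) \<Rightarrow> 'b measure \<Rightarrow> ('b \<Rightarrow> 'k) \<Rightarrow> bool" where
  "K_gaussian absv M X \<longleftrightarrow>
     (let \<mu> = distr M (Kborel absv) X in
      \<forall>a11 a12 a21 a22. orthonormal2 absv (a11, a12) (a21, a22) \<longrightarrow>
        distr (\<mu> \<Otimes>\<^sub>M \<mu>) (Kborel absv \<Otimes>\<^sub>M Kborel absv)
          (\<lambda>(x1, x2). (a11 * x1 + a12 * x2, a21 * x1 + a22 * x2)) = \<mu> \<Otimes>\<^sub>M \<mu>)"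

end

theory Submission
  imports Defs
begin

text \<open>Let \<open>\<phi>(\<xi>) = E[\<chi>(\<xi>X)]\<close>. If \<open>X\<close> is \<open>K\<close>-Gaussian then, for \<open>|a| \<le> 1\<close>, the orthonormal pair
  \<open>(1, a), (0, 1)\<close> shows that \<open>X\<^sub>1 + a X\<^sub>2\<close> has the law of \<open>X\<^sub>1\<close>, that is
  \<open>\<phi>(\<xi>) = \<phi>(\<xi>) \<phi>(a\<xi>)\<close>. So \<open>\<phi>(\<xi>) \<noteq> 0\<close> forces \<open>\<phi> = 1\<close> on the disc of radius \<open>|\<xi>|\<close>, and since \<open>\<phi>\<close> is
  continuous at \<open>0\<close> and not identically \<open>1\<close>, it is the indicator function of a disc. Such an
  indicator function is also the characteristic function of the uniform distribution on the dual
  disc, and Fourier inversion gives uniqueness. Conversely, a matrix with orthonormal rows lies in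
  \<open>GL\<^sub>2(D)\<close>; it is therefore an isometry of \<open>K\<^sup>2\<close> and permutes the product discs of a given radius,
  which preserves the product of two copies of a uniform distribution.\<close>

locale local_field =
  fixes absv :: "'k::field \<Rightarrow> real" and q :: nat and \<rho> :: 'k
  assumes data: "local_field_data absv q \<rho>"
begin

section \<open>The absolute value and the powers of \<open>q\<close>\<close>

lemma absv_eq_0_iff [simp]: "absv x = 0 \<longleftrightarrow> x = 0"
  and absv_mult: "absv (x * y) = absv x * absv y"
  and absv_add: "absv (x + y) \<le> max (absv x) (absv y)"
  and absv_values: "x \<noteq> 0 \<Longrightarrow> \<exists>k::int. absv x = real q powi k"
  and absv_uniformizer: "absv \<rho> = 1 / real q"
  and card_residue_field: "card {{a + \<rho> * y | y. y \<in> Dball absv} | a. a \<in> Dball absv} = q"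
  using data by (simp_all add: local_field_data_def)

lemma q_gt_1: "1 < q"
proof -
  obtain p c where "prime p" "c \<ge> 1" "q = p ^ c"
    using data by (auto simp: local_field_data_def)
  moreover from this have "1 < p" using prime_gt_1_nat by blast
  ultimately show ?thesis using one_less_power[of p c] by simp
qed

lemma q_powi_pos [simp]: "0 < real q powi k"
  using q_gt_1 by simp

lemma q_powi_nonneg [simp]: "0 \<le> real q powi k"
  by simp

lemma q_powi_le_iff [simp]: "real q powi k \<le> real q powi l \<longleftrightarrow> k \<le> l"
  using q_gt_1 power_int_strict_increasing[of l k "real q"]
    power_int_increasing[of k l "real q"] by (metis less_imp_le not_le of_nat_1 of_nat_less_iff)

lemma q_powi_less_iff [simp]: "real q powi k < real q powi l \<longleftrightarrow> k < l"
  by (metis linorder_not_le q_powi_le_iff)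

lemma q_powi_add: "real q powi (k + l) = real q powi k * real q powi l"
  using q_gt_1 by (simp add: power_int_add)

lemma absv_0 [simp]: "absv 0 = 0"
  by (simp only: absv_eq_0_iff)

lemma absv_nonneg [simp]: "0 \<le> absv x"
  by (metis absv_0 absv_values order_refl q_powi_nonneg)

lemma absv_pos_iff [simp]: "0 < absv x \<longleftrightarrow> x \<noteq> 0"
  by (metis absv_eq_0_iff absv_nonneg less_eq_real_def less_irrefl)

lemma absv_1 [simp]: "absv 1 = 1"
  using absv_mult[of 1 1] by auto

lemma absv_minus [simp]: "absv (- x) = absv x"
proof -
  have "absv (-1) * absv (-1) = 1"
    by (simp flip: absv_mult)
  then have "absv (-1) = 1"
    by (metis absv_nonneg abs_of_nonneg abs_square_eq_1 power2_eq_square)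
  then show ?thesis
    using absv_mult[of "-1" x] by simp
qed

lemma absv_diff: "absv (x - y) \<le> max (absv x) (absv y)"
  using absv_add[of x "- y"] by simp

lemma absv_commute: "absv (x - y) = absv (y - x)"
  using absv_minus[of "x - y"] by simp

lemma absv_inverse: "absv (inverse x) = inverse (absv x)"
proof (cases "x = 0")
  case False
  then have "absv x * absv (inverse x) = 1" by (simp flip: absv_mult)
  then show ?thesis by (metis inverse_unique)
qed simp

lemma absv_power: "absv (x ^ n) = absv x ^ n"
  by (induction n) (simp_all add: absv_mult)

lemma absv_powi: "absv (x powi k) = absv x powi k"
  by (simp add: power_int_def absv_power absv_inverse)

lemma absv_uniformizer_powi: "absv (\<rho> powi k) = real q powi (- k)"
  by (simp add: absv_powi absv_uniformizer power_int_minus power_int_inverse divide_inverse)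

subsection \<open>Discs\<close>

text \<open>Radii are given by exponents because every nonzero absolute value is an integer power of
  \<open>q\<close>. Thus \<open>disc 0 m\<close> is \<open>\<rho> powi (- m)\<close> times
  \<open>D\<close>.\<close>

definition disc :: "'k \<Rightarrow> int \<Rightarrow> 'k set" where
  "disc a m = {x. absv (x - a) \<le> real q powi m}"

lemma disc_0: "disc 0 m = {x. absv x \<le> real q powi m}"
  by (simp add: disc_def)

lemma disc_0_0: "disc 0 0 = Dball absv"
  by (simp add: disc_0 Dball_def)

lemma center_in_disc [simp]: "a \<in> disc a m"
  by (simp add: disc_def)

lemma disc_mono: "m \<le> l \<Longrightarrow> disc a m \<subseteq> disc a l"
  by (auto simp: disc_def intro: order_trans)

text \<open>By the ultrametric inequality every point of a disc is a centre of it.\<close>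

lemma disc_eq: "b \<in> disc a m \<Longrightarrow> disc b m = disc a m"
proof -
  have *: "disc b m \<subseteq> disc a m" if "b \<in> disc a m" for a b
  proof
    fix x assume "x \<in> disc b m"
    with that show "x \<in> disc a m"
      using absv_add[of "x - b" "b - a"] by (auto simp: disc_def)
  qed
  assume b: "b \<in> disc a m"
  then have "a \<in> disc b m" by (simp add: disc_def absv_commute)
  with b * show ?thesis by blast
qed

text \<open>A common point can serve as centre of both discs, and then only the radii are
  compared.\<close>

lemma discs_nested: "m \<le> l \<Longrightarrow> disc a m \<inter> disc b l \<noteq> {} \<Longrightarrow> disc a m \<subseteq> disc b l"
  by (metis disc_eq disc_mono disjoint_iff)

lemma add_image_disc: "(+) c ` disc a m = disc (c + a) m"
proof -
  have "x \<in> (+) c ` disc a m" if "x \<in> disc (c + a) m" for x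
    by (rule image_eqI[of _ _ "x - c"]) (use that in \<open>auto simp: disc_def algebra_simps\<close>)
  then show ?thesis by (auto simp: disc_def)
qed

lemma times_image_disc:
  assumes "absv t = real q powi j"
  shows "(*) t ` disc a m = disc (t * a) (j + m)"
proof -
  have t: "t \<noteq> 0" using assms q_powi_pos[of j] by force
  have *: "absv (t * x - t * a) = real q powi j * absv (x - a)" for x
    using assms absv_mult[of t "x - a"] by (simp add: right_diff_distrib)
  have "x \<in> (*) t ` disc a m" if "x \<in> disc (t * a) (j + m)" for x
    by (rule image_eqI[of _ _ "x / t"])
      (use that t *[of "x / t"] in \<open>auto simp: disc_def q_powi_add\<close>)
  then show ?thesis by (auto simp: disc_def * q_powi_add)
qed

lemma ex_q_powi_le:
  assumes "0 < (e::real)" obtains m :: int where "real q powi m < e"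
proof -
  obtain n where "(1 / real q) ^ n < e"
    using assms real_arch_pow_inv[of e "1 / real q"] q_gt_1 by auto
  then show thesis
    using that[of "- int n"] by (simp add: power_int_minus power_inverse divide_inverse)
qed

lemma ex_absv_le: obtains n :: nat where "absv x \<le> real q powi int n"
proof -
  obtain n where "absv x < real q ^ n"
    using real_arch_pow[of "real q" "absv x"] q_gt_1 by auto
  then show thesis using that[of n] by simp
qed

text \<open>For \<open>m = 0\<close> these discs are the cosets of \<open>\<rho> D\<close> in
  \<open>D\<close>, counted by the residue field. Multiplication by \<open>\<rho> powi (- m)\<close>
  carries that case to any other radius.\<close>

lemma residue_discs:
  "card ((\<lambda>a. disc a (m - 1)) ` disc 0 m) = q"
proof -
  have coset: "{a + \<rho> * y | y. y \<in> Dball absv} = disc a (- 1)" for a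
  proof -
    have "{a + \<rho> * y | y. y \<in> Dball absv} = (+) a ` (*) \<rho> ` disc 0 0"
      by (auto simp: disc_0_0)
    also have "(*) \<rho> ` disc 0 0 = disc 0 (-1)"
      using times_image_disc[of \<rho> "-1" 0 0] absv_uniformizer_powi[of 1] by simp
    finally show ?thesis by (simp add: add_image_disc)
  qed
  define t where "t = \<rho> powi (- m)"
  have t: "absv t = real q powi m" by (simp add: t_def absv_uniformizer_powi)
  then have "t \<noteq> 0" using q_powi_pos[of m] by force
  then have inj: "inj ((*) t)" by (simp add: inj_def)
  have 1: "(\<lambda>a. disc a (m - 1)) ` disc 0 m = (`) ((*) t) ` (\<lambda>a. disc a (-1)) ` disc 0 0"
  proof -
    have "disc 0 m = (*) t ` disc 0 0" using times_image_disc[OF t, of 0 0] by simp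
    then have "(\<lambda>a. disc a (m - 1)) ` disc 0 m = (\<lambda>a. disc (t * a) (m - 1)) ` disc 0 0"
      by (simp add: image_image)
    then show ?thesis by (simp add: image_image times_image_disc[OF t])
  qed
  have "card ((\<lambda>a. disc a (m - 1)) ` disc 0 m) = card ((\<lambda>a. disc a (-1)) ` disc 0 0)"
    unfolding 1 by (rule card_image) (meson inj inj_image_eq_iff inj_onI)
  also have "\<dots> = q"
    using card_residue_field by (simp add: coset disc_0_0 image_def Setcompr_eq_image)
  finally show ?thesis .
qed

text \<open>An infinite set has \<open>card\<close> equal to 0, so the positive count
  \<open>q\<close> already implies finiteness.\<close>

lemma finite_residue_discs: "finite ((\<lambda>a. disc a (m - 1)) ` disc 0 m)"
  using residue_discs[of m] q_gt_1 by (metis card.infinite not_one_less_zero)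

lemma finite_discs_in_disc: "finite ((\<lambda>a. disc a (m - int n)) ` disc 0 m)"
proof (induction n)
  case 0
  have "(\<lambda>a. disc a m) ` disc 0 m = {disc 0 m}"
    using disc_eq by (auto intro!: image_eqI[of _ _ 0])
  then show ?case by simp
next
  case (Suc n)
  let ?l = "m - int n"
  have l: "m - int (Suc n) = ?l - 1" by simp
  obtain R where R: "finite R" "(\<lambda>a. disc a ?l) ` disc 0 m = (\<lambda>a. disc a ?l) ` R"
    using Suc by (metis finite_subset_image order_refl)
  \<comment> \<open>Each disc of exponent \<open>?l\<close> is represented by some \<open>r\<close>
    in the finite set \<open>R\<close>; translation by \<open>r\<close> reduces its subdiscs to
    those of \<open>disc 0 ?l\<close>.\<close>
  have "(\<lambda>a. disc a (?l - 1)) ` disc 0 m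
      \<subseteq> (\<Union>r\<in>R. (`) ((+) r) ` ((\<lambda>a. disc a (?l - 1)) ` disc 0 ?l))"
  proof clarify
    fix a assume "a \<in> disc 0 m"
    then obtain r where r: "r \<in> R" "disc a ?l = disc r ?l" using R(2) by blast
    then have "a \<in> disc r ?l" using center_in_disc by blast
    then have "a - r \<in> disc 0 ?l" by (simp add: disc_def)
    moreover have "disc a (?l - 1) = (+) r ` disc (a - r) (?l - 1)" by (simp add: add_image_disc)
    ultimately show "disc a (?l - 1) \<in> (\<Union>r\<in>R. (`) ((+) r) ` ((\<lambda>a. disc a (?l - 1)) ` disc 0 ?l))"
      using r(1) by blast
  qed
  then show ?case unfolding l
    by (rule finite_subset) (intro finite_UN_I finite_imageI finite_residue_discs R(1))
qed

text \<open>The discs \<open>disc 0 (int l)\<close> exhaust the field, and each contributes finitely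
  many discs of every smaller or equal radius. This plays the part of second countability.\<close>

lemma countable_discs: "countable (range (\<lambda>(a, m). disc a m))"
proof -
  have "range (\<lambda>(a, m). disc a m)
      \<subseteq> (\<Union>l::nat. \<Union>n::nat. (\<lambda>a. disc a (int l - int n)) ` disc 0 (int l))"
  proof clarify
    fix a m
    obtain k where k: "absv a \<le> real q powi int k" by (rule ex_absv_le)
    \<comment> \<open>Large enough both to have \<open>a\<close> in \<open>disc 0 (int ?l)\<close>
      and to dominate \<open>m\<close>, so that \<open>int ?l - m\<close> is a natural
      number.\<close>
    let ?l = "k + nat m"
    have "real q powi int k \<le> real q powi int ?l" by (subst q_powi_le_iff) simp
    with k have "a \<in> disc 0 (int ?l)" unfolding disc_0 by (auto intro: order_trans)
    then have "disc a (int ?l - int (nat (int ?l - m)))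
        \<in> (\<Union>l::nat. \<Union>n::nat. (\<lambda>a. disc a (int l - int n)) ` disc 0 (int l))"
      by blast
    moreover have "int ?l - int (nat (int ?l - m)) = m" by simp
    ultimately show "disc a m \<in> (\<Union>l::nat. \<Union>n::nat. (\<lambda>a. disc a (int l - int n)) ` disc 0 (int l))"
      by simp
  qed
  then show ?thesis
    by (rule countable_subset)
      (intro countable_UN countableI_type countable_finite finite_discs_in_disc)
qed


subsection \<open>The Borel structure\<close>

lemma metric: "Metric_space UNIV (\<lambda>x y. absv (x - y))"
proof
  fix x y z :: 'k
  show "absv (x - z) \<le> absv (x - y) + absv (y - z)"
    using absv_add[of "x - y" "y - z"] by (simp add: max_def split: if_splits)
      (metis absv_nonneg add.commute add_increasing2 order_trans)+
qed (simp_all add: absv_commute)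

text \<open>Powers of \<open>q\<close> get arbitrarily small, so discs and metric balls can be
  inscribed in each other.\<close>

lemma openin_iff: "openin (Ktop absv) U \<longleftrightarrow> (\<forall>x\<in>U. \<exists>m. disc x m \<subseteq> U)"
proof -
  interpret Metric_space UNIV "\<lambda>x y. absv (x - y)" by (rule metric)
  have "(\<exists>r>0. mball x r \<subseteq> U) \<longleftrightarrow> (\<exists>m. disc x m \<subseteq> U)" for x
  proof
    assume "\<exists>r>0. mball x r \<subseteq> U"
    then obtain r where r: "r > 0" "mball x r \<subseteq> U" by blast
    obtain m where m: "real q powi m < r" by (rule ex_q_powi_le[OF r(1)])
    have "disc x m \<subseteq> mball x r"
      using m by (auto simp: disc_def absv_commute[of x])
    with r show "\<exists>m. disc x m \<subseteq> U" by blast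
  next
    assume "\<exists>m. disc x m \<subseteq> U"
    then obtain m where m: "disc x m \<subseteq> U" by blast
    have "mball x (real q powi m) \<subseteq> disc x m"
      by (auto simp: disc_def absv_commute[of x])
    with m show "\<exists>r>0. mball x r \<subseteq> U"
      by (intro exI[of _ "real q powi m"]) auto
  qed
  then show ?thesis
    by (simp add: Ktop_def openin_mtopology Ball_def)
qed

lemma openin_disc: "openin (Ktop absv) (disc a m)"
  unfolding openin_iff using disc_eq by blast

lemma open_eq_Union_discs:
  assumes "openin (Ktop absv) U"
  obtains C where "countable C" "C \<subseteq> range (\<lambda>(a, m). disc a m)" "U = \<Union>C"
proof
  \<comment> \<open>All discs inside \<open>U\<close> may be taken at once, since there are only
    countably many discs.\<close>
  let ?C = "{A \<in> range (\<lambda>(a, m). disc a m). A \<subseteq> U}"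
  show "countable ?C" by (rule countable_subset[OF _ countable_discs]) blast
  show "U = \<Union>?C"
  proof
    show "U \<subseteq> \<Union>?C"
    proof
      fix x assume "x \<in> U"
      then obtain m where "disc x m \<subseteq> U" using assms openin_iff by blast
      then show "x \<in> \<Union>?C" by (intro UnionI[of "disc x m"]) auto
    qed
  qed blast
qed blast

lemma space_Kborel [simp]: "space (Kborel absv) = UNIV"
  by (simp add: Kborel_def space_measure_of_conv)

lemma sets_Kborel: "sets (Kborel absv) = sigma_sets UNIV (range (\<lambda>(a, m). disc a m))"
proof -
  have "sigma_sets UNIV {U. openin (Ktop absv) U} = sigma_sets UNIV (range (\<lambda>(a, m). disc a m))"
  proof (rule sigma_sets_eqI)
    fix U assume "U \<in> {U. openin (Ktop absv) U}"
    then obtain C where C: "countable C" "C \<subseteq> range (\<lambda>(a, m). disc a m)" "U = \<Union>C"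
      using open_eq_Union_discs by blast
    then show "U \<in> sigma_sets UNIV (range (\<lambda>(a, m). disc a m))"
      by (auto intro!: sigma_sets_UNION)
  qed (auto simp: openin_disc intro: sigma_sets.Basic)
  then show ?thesis by (simp add: Kborel_def sets_measure_of_conv)
qed

lemma disc_in_sets [measurable]: "disc a m \<in> sets (Kborel absv)"
  unfolding sets_Kborel by (rule sigma_sets.Basic) auto

text \<open>A point is the intersection of the discs of exponents \<open>- int n\<close> around it.
  The case of \<open>{0}\<close> makes \<open>X = 0\<close> an event.\<close>

lemma singleton_in_sets: "{a} \<in> sets (Kborel absv)"
proof -
  have "x = a" if "\<And>n::nat. x \<in> disc a (- int n)" for x
  proof (rule ccontr)
    assume "x \<noteq> a"
    then obtain k where k: "absv (x - a) = real q powi k" using absv_values[of "x - a"] by auto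
    \<comment> \<open>The successor makes the radius strictly smaller than the distance from
      \<open>x\<close> to \<open>a\<close>.\<close>
    have "- int (Suc (nat (- k))) < k" by simp
    then have "real q powi (- int (Suc (nat (- k)))) < absv (x - a)" unfolding k q_powi_less_iff .
    with that[of "Suc (nat (- k))"] show False by (simp add: disc_def)
  qed
  then have "{a} = (\<Inter>n::nat. disc a (- int n))" by (auto simp del: of_nat_Suc)
  also have "\<dots> \<in> sets (Kborel absv)" by (rule sets.countable_INT) auto
  finally show ?thesis .
qed

text \<open>These are the balls of \<open>K^2\<close> for the maximum norm. Both factors have the
  same radius, so that linear isometries map such sets to one another.\<close>

definition square_discs :: "('k \<times> 'k) set set" where
  "square_discs = (\<lambda>(a, b, m). disc a m \<times> disc b m) ` UNIV"

lemma disc_times_disc_in_square_discs: "disc a m \<times> disc b m \<in> square_discs"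
  unfolding square_discs_def by (rule image_eqI[of _ _ "(a, b, m)"]) auto

lemma countable_square_discs: "countable square_discs"
proof -
  let ?R = "range (\<lambda>(a, m). disc a m)"
  have "square_discs \<subseteq> (\<lambda>(A, B). A \<times> B) ` (?R \<times> ?R)"
    by (auto simp: square_discs_def image_iff)
  then show ?thesis
    by (rule countable_subset) (intro countable_image countable_SIGMA countable_discs)
qed

text \<open>The squares contained in \<open>W\<close> cover it and form a countable family.\<close>

lemma open_in_sigma_square_discs:
  assumes "\<And>x y. (x, y) \<in> W \<Longrightarrow> \<exists>m. disc x m \<times> disc y m \<subseteq> W"
  shows "W \<in> sigma_sets UNIV square_discs"
proof -
  let ?C = "{A \<in> square_discs. A \<subseteq> W}"
  have "W \<subseteq> \<Union>?C"
  proof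
    fix z assume z: "z \<in> W"
    obtain x y where xy: "z = (x, y)" by fastforce
    with z assms obtain m where "disc x m \<times> disc y m \<subseteq> W" by blast
    with xy show "z \<in> \<Union>?C"
      by (intro UnionI[of "disc x m \<times> disc y m"]) (auto simp: disc_times_disc_in_square_discs)
  qed
  then have "W = \<Union>?C" by blast
  also have "\<dots> \<in> sigma_sets UNIV square_discs"
    by (rule sigma_sets_UNION)
      (auto intro: countable_subset[OF _ countable_square_discs])
  finally show ?thesis .
qed

text \<open>Rectangles of discs generate the product sigma-algebra, and each one is open, hence a
  countable union of squares.\<close>

lemma sets_pair_Kborel:
  "sets (Kborel absv \<Otimes>\<^sub>M Kborel absv) = sigma_sets UNIV square_discs"
proof
  let ?R = "range (\<lambda>(a, m). disc a m)"
  obtain C where C: "countable C" "C \<subseteq> ?R" "UNIV = \<Union>C"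
    by (rule open_eq_Union_discs[of UNIV]) (auto simp: openin_iff)
  have "sets (Kborel absv \<Otimes>\<^sub>M Kborel absv) = sets (sigma (UNIV \<times> UNIV) {A \<times> B | A B. A \<in> ?R \<and> B \<in> ?R})"
    using sets_pair_eq[of ?R "Kborel absv" C ?R "Kborel absv" C] C by (simp add: sets_Kborel)
  also have "\<dots> = sigma_sets UNIV {A \<times> B | A B. A \<in> ?R \<and> B \<in> ?R}"
    by (simp add: sets_measure_of_conv)
  also have "\<dots> \<subseteq> sigma_sets UNIV square_discs"
  proof (rule sigma_sets_mono, clarify)
    fix a b m l
    show "disc a m \<times> disc b l \<in> sigma_sets UNIV square_discs"
    proof (rule open_in_sigma_square_discs)
      fix x y assume xy: "(x, y) \<in> disc a m \<times> disc b l"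
      \<comment> \<open>Recentre both factors at the given point, then shrink to the smaller of the
        two radii.\<close>
      then have "disc x m = disc a m" "disc y l = disc b l" by (simp_all add: disc_eq)
      then have "disc x (min m l) \<times> disc y (min m l) \<subseteq> disc a m \<times> disc b l"
        using disc_mono[of "min m l" m x] disc_mono[of "min m l" l y] by auto
      then show "\<exists>k. disc x k \<times> disc y k \<subseteq> disc a m \<times> disc b l" by blast
    qed
  qed
  finally show "sets (Kborel absv \<Otimes>\<^sub>M Kborel absv) \<subseteq> sigma_sets UNIV square_discs" .
  have "square_discs \<subseteq> sets (Kborel absv \<Otimes>\<^sub>M Kborel absv)"
    by (auto simp: square_discs_def)
  then show "sigma_sets UNIV square_discs \<subseteq> sets (Kborel absv \<Otimes>\<^sub>M Kborel absv)"
    using sets.sigma_sets_subset[of square_discs "Kborel absv \<Otimes>\<^sub>M Kborel absv"]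
    by (simp add: space_pair_measure)
qed

section \<open>Borel measurability of the field operations\<close>

lemma measurable_pair_Kborel:
  assumes "\<And>x y m. \<exists>k. \<forall>u\<in>disc x k. \<forall>v\<in>disc y k. f (u, v) \<in> disc (f (x, y)) m"
  shows "f \<in> Kborel absv \<Otimes>\<^sub>M Kborel absv \<rightarrow>\<^sub>M Kborel absv"
proof (rule measurableI)
  fix A assume "A \<in> sets (Kborel absv)"
  then have "A \<in> sigma_sets UNIV (range (\<lambda>(a, m). disc a m))" by (simp add: sets_Kborel)
  then have "f -` A \<in> sigma_sets UNIV square_discs"
  proof induction
    case (Basic A)
    then obtain a m where A: "A = disc a m" by auto
    show ?case
    \<comment> \<open>The assumption on \<open>f\<close> is continuity at each point, so the
      preimage of a disc contains a square around each of its points.\<close>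
    proof (rule open_in_sigma_square_discs)
      fix x y assume "(x, y) \<in> f -` A"
      then have "disc (f (x, y)) m = A" using A disc_eq by auto
      then show "\<exists>k. disc x k \<times> disc y k \<subseteq> f -` A"
        using assms[of x y m] by fastforce
    qed
  next
    case (Compl A)
    then show ?case by (metis sigma_sets.Compl vimage_Diff vimage_UNIV)
  next
    case (Union A)
    then show ?case by (simp add: vimage_UN sigma_sets.Union)
  qed (simp add: sigma_sets.Empty)
  then show "f -` A \<inter> space (Kborel absv \<Otimes>\<^sub>M Kborel absv) \<in> sets (Kborel absv \<Otimes>\<^sub>M Kborel absv)"
    by (simp add: sets_pair_Kborel space_pair_measure)
qed simp

lemma Kborel_add_measurable:
  "(\<lambda>(x, y). x + y) \<in> Kborel absv \<Otimes>\<^sub>M Kborel absv \<rightarrow>\<^sub>M Kborel absv"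
proof (rule measurable_pair_Kborel, intro exI ballI)
  fix x y u v m assume "u \<in> disc x m" "v \<in> disc y m"
  then show "(case (u, v) of (x, y) \<Rightarrow> x + y) \<in> disc (case (x, y) of (x, y) \<Rightarrow> x + y) m"
    using absv_add[of "u - x" "v - y"] by (simp add: disc_def algebra_simps)
qed

lemma Kborel_mult_measurable:
  "(\<lambda>(x, y). x * y) \<in> Kborel absv \<Otimes>\<^sub>M Kborel absv \<rightarrow>\<^sub>M Kborel absv"
proof (rule measurable_pair_Kborel)
  fix x y m
  obtain i where i: "absv x \<le> real q powi int i" by (rule ex_absv_le)
  obtain j where j: "absv y \<le> real q powi int j" by (rule ex_absv_le)
  \<comment> \<open>With this \<open>k\<close> the exponents \<open>k + k\<close>,
    \<open>k + int j\<close> and \<open>int i + k\<close> are all at most \<open>m\<close>; taking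
    \<open>min m 0\<close> serves the quadratic one, as \<open>2 * m\<close> exceeds
    \<open>m\<close> for positive \<open>m\<close>.\<close>
  define k where "k = min m 0 - int i - int j"
  show "\<exists>k. \<forall>u\<in>disc x k. \<forall>v\<in>disc y k.
      (case (u, v) of (x, y) \<Rightarrow> x * y) \<in> disc (case (x, y) of (x, y) \<Rightarrow> x * y) m"
  proof (intro exI[of _ k] ballI)
    fix u v assume "u \<in> disc x k" "v \<in> disc y k"
    then have u: "absv (u - x) \<le> real q powi k" and v: "absv (v - y) \<le> real q powi k"
      by (auto simp: disc_def)
    have "absv ((u - x) * (v - y)) \<le> real q powi (k + k)"
      unfolding absv_mult q_powi_add by (intro mult_mono u v) auto
    moreover have "absv ((u - x) * y) \<le> real q powi (k + int j)"
      unfolding absv_mult q_powi_add by (intro mult_mono u j) auto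
    moreover have "absv (x * (v - y)) \<le> real q powi (int i + k)"
      unfolding absv_mult q_powi_add by (intro mult_mono i v) auto
    moreover have "k + k \<le> m" "k + int j \<le> m" "int i + k \<le> m" by (auto simp: k_def)
    ultimately have "absv ((u - x) * (v - y)) \<le> real q powi m"
      "absv ((u - x) * y) \<le> real q powi m" "absv (x * (v - y)) \<le> real q powi m"
      using q_powi_le_iff order_trans by blast+
    moreover have "u * v - x * y = (u - x) * (v - y) + (u - x) * y + x * (v - y)"
      by (simp add: algebra_simps)
    ultimately have "absv (u * v - x * y) \<le> real q powi m"
      using absv_add[of "(u - x) * (v - y) + (u - x) * y" "x * (v - y)"]
        absv_add[of "(u - x) * (v - y)" "(u - x) * y"] by simp
    then show "(case (u, v) of (x, y) \<Rightarrow> x * y) \<in> disc (case (x, y) of (x, y) \<Rightarrow> x * y) m"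
      by (simp add: disc_def)
  qed
qed

lemma Kborel_add [measurable (raw)]:
  assumes "f \<in> N \<rightarrow>\<^sub>M Kborel absv" "g \<in> N \<rightarrow>\<^sub>M Kborel absv"
  shows "(\<lambda>x. f x + g x) \<in> N \<rightarrow>\<^sub>M Kborel absv"
  using measurable_compose[OF measurable_Pair[OF assms] Kborel_add_measurable] by simp

lemma Kborel_mult [measurable (raw)]:
  assumes "f \<in> N \<rightarrow>\<^sub>M Kborel absv" "g \<in> N \<rightarrow>\<^sub>M Kborel absv"
  shows "(\<lambda>x. f x * g x) \<in> N \<rightarrow>\<^sub>M Kborel absv"
  using measurable_compose[OF measurable_Pair[OF assms] Kborel_mult_measurable] by simp

section \<open>Probability measures are determined by their values on discs and squares\<close>

lemma Kborel_measure_eqI: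
  assumes "prob_space \<mu>" "prob_space \<nu>"
    and sets: "sets \<mu> = sets (Kborel absv)" "sets \<nu> = sets (Kborel absv)"
    and eq: "\<And>a m. emeasure \<mu> (disc a m) = emeasure \<nu> (disc a m)"
  shows "\<mu> = \<nu>"
proof (rule measure_eqI_generator_eq[where \<Omega> = UNIV and A = "\<lambda>n::nat. disc 0 (int n)"
      and E = "insert {} (range (\<lambda>(a, m). disc a m))"])
  interpret \<mu>: prob_space \<mu> by fact
  \<comment> \<open>Discs that meet are nested, so adjoining the empty set gives a generator stable
    under intersection.\<close>
  have "disc a m \<inter> disc b l \<in> insert {} (range (\<lambda>(a, m). disc a m))" for a b m l
  proof (cases "disc a m \<inter> disc b l = {}")
    case False
    then have "disc a m \<inter> disc b l = disc a m \<or> disc a m \<inter> disc b l = disc b l"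
      using discs_nested[of m l a b] discs_nested[of l m b a] by (cases "m \<le> l") auto
    then show ?thesis by auto
  qed simp
  then show "Int_stable (insert {} (range (\<lambda>(a, m). disc a m)))"
    by (auto simp: Int_stable_def)
  have "sigma_sets UNIV (insert {} (range (\<lambda>(a, m). disc a m))) = sets (Kborel absv)"
    unfolding sets_Kborel by (rule sigma_sets_eqI) (auto intro: sigma_sets.intros)
  with sets show "sets \<mu> = sigma_sets UNIV (insert {} (range (\<lambda>(a, m). disc a m)))"
    "sets \<nu> = sigma_sets UNIV (insert {} (range (\<lambda>(a, m). disc a m)))"
    by simp_all
  have "x \<in> (\<Union>n. disc 0 (int n))" for x
    using ex_absv_le[of x] by (auto simp: disc_0)
  then show "(\<Union>n. disc 0 (int n)) = UNIV" by blast
  show "\<And>i. emeasure \<mu> (disc 0 (int i)) \<noteq> \<infinity>" by simp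
qed (auto simp: eq)

lemma Kborel_pair_measure_eqI:
  assumes "prob_space \<mu>" "prob_space \<nu>"
    and sets: "sets \<mu> = sets (Kborel absv \<Otimes>\<^sub>M Kborel absv)"
      "sets \<nu> = sets (Kborel absv \<Otimes>\<^sub>M Kborel absv)"
    and eq: "\<And>a b m. emeasure \<mu> (disc a m \<times> disc b m) = emeasure \<nu> (disc a m \<times> disc b m)"
  shows "\<mu> = \<nu>"
proof (rule measure_eqI_generator_eq[where \<Omega> = UNIV
      and A = "\<lambda>n::nat. disc 0 (int n) \<times> disc 0 (int n)" and E = "insert {} square_discs"])
  interpret \<mu>: prob_space \<mu> by fact
  have *: "A \<inter> B \<in> insert {} square_discs" if AB: "A \<in> square_discs" "B \<in> square_discs" for A B
  proof (cases "A \<inter> B = {}")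
    case False
    obtain a b m c d l where eqs: "A = disc a m \<times> disc b m" "B = disc c l \<times> disc d l"
      using AB by (auto simp: square_discs_def)
    have ne: "disc a m \<inter> disc c l \<noteq> {}" "disc b m \<inter> disc d l \<noteq> {}"
      using False by (auto simp: eqs)
    \<comment> \<open>Each square has a single radius, so the comparison of \<open>m\<close> and
      \<open>l\<close> decides the inclusion in both coordinates alike.\<close>
    have "A \<subseteq> B \<or> B \<subseteq> A"
    proof (cases "m \<le> l")
      case True
      then have "disc a m \<subseteq> disc c l" "disc b m \<subseteq> disc d l"
        using ne discs_nested by blast+
      then show ?thesis by (auto simp: eqs)
    next
      case False
      then have "disc c l \<subseteq> disc a m" "disc d l \<subseteq> disc b m"
        using ne discs_nested[of l m c a] discs_nested[of l m d b] by (auto simp: Int_commute)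
      then show ?thesis by (auto simp: eqs)
    qed
    then have "A \<inter> B = A \<or> A \<inter> B = B" by blast
    with AB show ?thesis by auto
  qed simp
  then show "Int_stable (insert {} square_discs)"
    by (auto simp: Int_stable_def)
  have "sigma_sets UNIV (insert {} square_discs) = sets (Kborel absv \<Otimes>\<^sub>M Kborel absv)"
    unfolding sets_pair_Kborel by (rule sigma_sets_eqI) (auto intro: sigma_sets.intros)
  with sets show "sets \<mu> = sigma_sets UNIV (insert {} square_discs)"
    "sets \<nu> = sigma_sets UNIV (insert {} square_discs)"
    by simp_all
  have "(x, y) \<in> (\<Union>n. disc 0 (int n) \<times> disc 0 (int n))" for x y
  proof -
    obtain i where i: "absv x \<le> real q powi int i" by (rule ex_absv_le)
    obtain j where j: "absv y \<le> real q powi int j" by (rule ex_absv_le)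
    have "x \<in> disc 0 (int (max i j))" "y \<in> disc 0 (int (max i j))"
      using i j disc_mono[of "int i" "int (max i j)" 0] disc_mono[of "int j" "int (max i j)" 0]
      by (auto simp: disc_0)
    then show ?thesis by blast
  qed
  then show "(\<Union>n. disc 0 (int n) \<times> disc 0 (int n)) = UNIV" by auto
  show "\<And>X. X \<in> insert {} square_discs \<Longrightarrow> emeasure \<mu> X = emeasure \<nu> X"
    by (auto simp: square_discs_def eq)
  show "\<And>i. emeasure \<mu> (disc 0 (int i) \<times> disc 0 (int i)) \<noteq> \<infinity>" by simp
qed (auto simp: disc_times_disc_in_square_discs)


subsection \<open>Orthonormal pairs\<close>

lemma orthonormal2_entries_le:
  assumes "orthonormal2 absv (a11, a12) (a21, a22)"
  shows "absv a11 \<le> 1" "absv a12 \<le> 1" "absv a21 \<le> 1" "absv a22 \<le> 1"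
  using assms by (auto simp: orthonormal2_def norm2_def max_def split: if_splits)

text \<open>The rows of the adjugate, used as coefficients, combine the given rows to
  \<open>(d, 0)\<close> and \<open>(0, d)\<close>, with \<open>d\<close> the determinant.
  Orthonormality then gives \<open>absv d\<close> as the maximum over either column, and some entry
  of the first row has absolute value 1.\<close>

lemma orthonormal2_det:
  assumes "orthonormal2 absv (a11, a12) (a21, a22)"
  shows "absv (a11 * a22 - a12 * a21) = 1"
proof -
  let ?d = "a11 * a22 - a12 * a21"
  have n: "max (absv a11) (absv a12) = 1"
    and o: "\<And>b1 b2. max (absv (b1 * a11 + b2 * a21)) (absv (b1 * a12 + b2 * a22))
      = max (absv b1) (absv b2)"
    using assms by (auto simp: orthonormal2_def norm2_def)
  have "max (absv a22) (absv a12) = absv ?d"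
    using o[of a22 "- a12"] by (simp add: algebra_simps)
  moreover have "max (absv a21) (absv a11) = absv ?d"
    using o[of "- a21" a11] by (simp add: algebra_simps)
  ultimately show ?thesis
    using n orthonormal2_entries_le[OF assms] by linarith
qed

lemma absv_linear_le:
  assumes "absv a \<le> 1" "absv b \<le> 1"
  shows "absv (a * x + b * y) \<le> max (absv x) (absv y)"
proof -
  have "absv (a * x) \<le> absv x" "absv (b * y) \<le> absv y"
    using assms by (simp_all add: absv_mult mult_left_le_one_le)
  then show ?thesis using absv_add[of "a * x" "b * y"] by linarith
qed

text \<open>The definition controls combinations of the rows, hence the transposed matrix, whereas
  here the matrix acts on a vector. Entries in \<open>D\<close> give one inequality; the adjugate,
  also with entries in \<open>D\<close>, and the unit determinant give the other.\<close>

lemma orthonormal2_isometry: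
  assumes "orthonormal2 absv (a11, a12) (a21, a22)"
  shows "max (absv (a11 * x + a12 * y)) (absv (a21 * x + a22 * y)) = max (absv x) (absv y)"
proof -
  let ?u = "a11 * x + a12 * y" and ?v = "a21 * x + a22 * y" and ?d = "a11 * a22 - a12 * a21"
  note le = orthonormal2_entries_le[OF assms]
  have "?d * x = a22 * ?u + (- a12) * ?v" "?d * y = (- a21) * ?u + a11 * ?v"
    by (simp_all add: algebra_simps)
  then have "absv (?d * x) \<le> max (absv ?u) (absv ?v)" "absv (?d * y) \<le> max (absv ?u) (absv ?v)"
    using le absv_linear_le[of a22 "- a12" ?u ?v] absv_linear_le[of "- a21" a11 ?u ?v] by simp_all
  moreover have "absv (?d * x) = absv x" "absv (?d * y) = absv y"
    using orthonormal2_det[OF assms] by (simp_all add: absv_mult)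
  ultimately show ?thesis
    using le absv_linear_le[of a11 a12 x y] absv_linear_le[of a21 a22 x y] by linarith
qed

lemma orthonormal2_surj:
  assumes "orthonormal2 absv (a11, a12) (a21, a22)"
  obtains x y where "a11 * x + a12 * y = u" "a21 * x + a22 * y = v"
proof -
  let ?d = "a11 * a22 - a12 * a21"
  have "?d \<noteq> 0" using orthonormal2_det[OF assms] by force
  then show thesis
    \<comment> \<open>Cramer's rule.\<close>
    by (intro that[of "(a22 * u - a12 * v) / ?d" "(a11 * v - a21 * u) / ?d"])
      (simp_all add: divide_simps, simp_all add: algebra_simps)
qed

lemma orthonormal2_shear:
  assumes "absv a \<le> 1"
  shows "orthonormal2 absv (1, a) (0, 1)"
proof -
  have "max (absv x) (absv (x * a + y)) = max (absv x) (absv y)" for x y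
  proof -
    have "absv (x * a) \<le> absv x" using assms by (simp add: absv_mult mult_right_le_one_le)
    then show ?thesis
      \<comment> \<open>The second inequality recovers \<open>y\<close> from
        \<open>x * a + y\<close>, so adding \<open>x * a\<close> does not change the
        maximum.\<close>
      using absv_add[of "x * a" y] absv_diff[of "x * a + y" "x * a"] by simp
  qed
  with assms show ?thesis by (simp add: orthonormal2_def norm2_def)
qed

text \<open>By linearity the isometry preserves distances to a centre, and a square is a ball for
  the maximum norm.\<close>

lemma vimage_square_disc:
  assumes "orthonormal2 absv (a11, a12) (a21, a22)"
  shows "(\<lambda>(x, y). (a11 * x + a12 * y, a21 * x + a22 * y)) -`
      (disc (a11 * a + a12 * b) m \<times> disc (a21 * a + a22 * b) m) = disc a m \<times> disc b m"
proof -
  have "absv (a11 * x + a12 * y - (a11 * a + a12 * b)) \<le> r \<and>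
      absv (a21 * x + a22 * y - (a21 * a + a22 * b)) \<le> r \<longleftrightarrow> absv (x - a) \<le> r \<and> absv (y - b) \<le> r"
    for x y r
    using orthonormal2_isometry[OF assms, of "x - a" "y - b"]
    by (simp add: algebra_simps flip: max.bounded_iff)
  then show ?thesis by (auto simp: disc_def)
qed

end

subsection \<open>Haar measure and uniform distributions\<close>

locale local_field_haar = local_field absv q \<rho>
  for absv :: "'k::field \<Rightarrow> real" and q \<rho> +
  fixes lam :: "'k measure"
  assumes haar: "normalized_haar absv lam"
begin

lemma sets_lam [measurable_cong]: "sets lam = sets (Kborel absv)"
  and emeasure_translate: "A \<in> sets (Kborel absv) \<Longrightarrow> emeasure lam ((+) a ` A) = emeasure lam A"
  and emeasure_Dball: "emeasure lam (Dball absv) = 1"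
  using haar by (auto simp: normalized_haar_def)

lemma space_lam [simp]: "space lam = UNIV"
  using sets_eq_imp_space_eq[OF sets_lam] by simp

lemma emeasure_disc_center: "emeasure lam (disc a m) = emeasure lam (disc 0 m)"
  using emeasure_translate[of "disc 0 m" a] by (simp add: add_image_disc)

text \<open>A disc is the disjoint union of \<open>q\<close> translates of the next smaller disc
  about 0. Indexing by the set of discs, not by centres, counts each of them once.\<close>

lemma emeasure_disc_step: "emeasure lam (disc 0 m) = of_nat q * emeasure lam (disc 0 (m - 1))"
proof -
  let ?C = "(\<lambda>a. disc a (m - 1)) ` disc 0 m"
  have disj: "disc a k \<inter> disc b k = {}" if "disc a k \<noteq> disc b k" for a b k
    using that by (metis disc_eq disjoint_iff)
  have "disc a (m - 1) \<subseteq> disc 0 m" if "a \<in> disc 0 m" for a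
    using that disc_mono[of "m - 1" m a] disc_eq[OF that] by simp
  then have "disc 0 m = \<Union>?C" by auto
  then have "emeasure lam (disc 0 m) = emeasure lam (\<Union>A\<in>?C. A)" by simp
  also have "\<dots> = (\<Sum>A\<in>?C. emeasure lam A)"
  proof (rule sum_emeasure[symmetric])
    show "disjoint_family_on (\<lambda>A. A) ?C"
      using disj by (auto simp: disjoint_family_on_def)
  qed (use finite_residue_discs sets_lam in auto)
  also have "\<dots> = (\<Sum>A\<in>?C. emeasure lam (disc 0 (m - 1)))"
    by (rule sum.cong) (auto intro: emeasure_disc_center)
  also have "\<dots> = of_nat q * emeasure lam (disc 0 (m - 1))"
    by (simp add: residue_discs)
  finally show ?thesis .
qed

text \<open>Starting from the normalisation at \<open>D\<close>, the factor \<open>q\<close> is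
  applied upwards and cancelled downwards.\<close>

lemma emeasure_disc: "emeasure lam (disc a m) = ennreal (real q powi m)"
proof -
  have "emeasure lam (disc 0 m) = ennreal (real q powi m)"
  proof (induction m rule: int_induct[of _ 0])
    case base
    then show ?case by (simp add: disc_0_0 emeasure_Dball)
  next
    case (step1 i)
    have "real q powi (i + 1) = real q * real q powi i" by (simp add: q_powi_add)
    then show ?case
      using step1 emeasure_disc_step[of "i + 1"]
      by (simp add: ennreal_of_nat_eq_real_of_nat ennreal_mult)
  next
    case (step2 i)
    have q: "0 < real q" using q_gt_1 by simp
    have eq: "real q powi i = real q * real q powi (i - 1)"
      using q_powi_add[of 1 "i - 1"] by simp
    have "ennreal (real q) * emeasure lam (disc 0 (i - 1)) = ennreal (real q) * ennreal (real q powi (i - 1))"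
      using step2 emeasure_disc_step[of i] by (simp add: eq ennreal_of_nat_eq_real_of_nat ennreal_mult)
    then show ?case
      using q by (simp add: ennreal_mult_cancel_left)
  qed
  then show ?thesis using emeasure_disc_center[of a m] by simp
qed

definition unif :: "int \<Rightarrow> 'k measure" where
  "unif n = uniform_measure lam (disc 0 n)"

lemma sets_unif [measurable_cong]: "sets (unif n) = sets (Kborel absv)"
  by (simp add: unif_def sets_lam)

lemma space_unif [simp]: "space (unif n) = UNIV"
  by (simp add: unif_def)

lemma prob_space_unif: "prob_space (unif n)"
  unfolding unif_def by (rule prob_space_uniform_measure) (use q_gt_1 in \<open>simp_all add: emeasure_disc\<close>)

text \<open>The disc has Haar measure \<open>q\<close> to the power \<open>n\<close>, whose
  reciprocal is the constant value of the density there.\<close>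

lemma density_eq_unif:
  "density lam (\<lambda>x. ennreal (real q powr (- real_of_int n)
      * Phi (real q powr (- real_of_int n) * absv x))) = unif n"
proof -
  have q: "0 < real q" using q_gt_1 by simp
  have powr: "real q powr (- real_of_int n) = inverse (real q powi n)"
    using q powr_real_of_int'[of "real q" n] by (simp add: powr_minus)
  have "ennreal (real q powr (- real_of_int n) * Phi (real q powr (- real_of_int n) * absv x))
      = indicator (disc 0 n) x / emeasure lam (disc 0 n)" for x
  proof (cases "x \<in> disc 0 n")
    case True
    then have "Phi (inverse (real q powi n) * absv x) = 1"
      by (simp add: Phi_def disc_0 field_simps)
    with True show ?thesis
      by (simp add: powr emeasure_disc divide_ennreal_def inverse_ennreal)
  next
    case False
    then have "Phi (inverse (real q powi n) * absv x) = 0"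
      by (simp add: Phi_def disc_0 field_simps)
    with False show ?thesis by (simp add: powr)
  qed
  then show ?thesis by (simp add: unif_def uniform_measure_def)
qed

text \<open>The disc is an additive subgroup, so translation by an element \<open>b\<close> maps it
  onto itself, and Haar measure is invariant.\<close>

lemma distr_translate_unif:
  assumes "b \<in> disc 0 n"
  shows "distr (unif n) (Kborel absv) ((+) b) = unif n"
proof (rule measure_eqI)
  fix A assume "A \<in> sets (distr (unif n) (Kborel absv) ((+) b))"
  then have A [measurable]: "A \<in> sets (Kborel absv)" by simp
  have pre [measurable]: "(+) b -` A \<in> sets (Kborel absv)"
    using measurable_sets[of "(+) b" "Kborel absv" "Kborel absv" A] by simp
  have "(+) b ` (disc 0 n \<inter> (+) b -` A) = (+) b ` disc 0 n \<inter> A" by auto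
  also have "(+) b ` disc 0 n = disc 0 n"
    using assms disc_eq[of b 0 n] by (simp add: add_image_disc)
  finally have "emeasure lam (disc 0 n \<inter> (+) b -` A) = emeasure lam (disc 0 n \<inter> A)"
    using emeasure_translate[of "disc 0 n \<inter> (+) b -` A" b] by simp
  then show "emeasure (distr (unif n) (Kborel absv) ((+) b)) A = emeasure (unif n) A"
    by (simp add: emeasure_distr) (simp add: unif_def sets_lam)
qed (simp add: sets_unif)

text \<open>The two discs are nested or disjoint, and \<open>absv a\<close> alone decides which. In
  this form the mass of a square depends on its centre only through the norm.\<close>

lemma emeasure_unif_disc:
  "emeasure (unif n) (disc a m) =
    (if absv a \<le> real q powi (max m n) then ennreal (real q powi (min m n)) / ennreal (real q powi n) else 0)"
proof -
  have "emeasure lam (disc 0 n \<inter> disc a m) =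
      (if absv a \<le> real q powi (max m n) then ennreal (real q powi (min m n)) else 0)"
  proof (cases "a \<in> disc 0 (max m n)")
    case True
    have "disc 0 n \<inter> disc a m = (if m \<le> n then disc a m else disc 0 n)"
    proof (cases "m \<le> n")
      case mn: True
      then have "disc a m \<subseteq> disc 0 n"
        using True disc_mono[of m n a] disc_eq[of a 0 n] by (simp add: max_def)
      with mn show ?thesis by auto
    next
      case False
      then have "disc 0 n \<subseteq> disc a m"
        using True disc_mono[of n m 0] disc_eq[of a 0 m] by (simp add: max_def)
      with False show ?thesis by auto
    qed
    then have "emeasure lam (disc 0 n \<inter> disc a m) = ennreal (real q powi (min m n))"
      by (simp add: emeasure_disc min_def)
    moreover have "absv a \<le> real q powi (max m n)" using True by (simp add: disc_0)
    ultimately show ?thesis by simp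
  next
    case False
    have "disc 0 n \<inter> disc a m = {}"
    proof (rule ccontr)
      assume "disc 0 n \<inter> disc a m \<noteq> {}"
      then obtain x where "x \<in> disc 0 (max m n)" "x \<in> disc a (max m n)"
        using disc_mono[of n "max m n" 0] disc_mono[of m "max m n" a] by auto
      then have "disc a (max m n) = disc 0 (max m n)" using disc_eq by metis
      with False show False using center_in_disc by blast
    qed
    with False show ?thesis by (simp add: disc_0)
  qed
  then show ?thesis by (simp add: unif_def sets_lam emeasure_disc)
qed

lemma distr_unif_orthonormal2:
  assumes on: "orthonormal2 absv (a11, a12) (a21, a22)"
  shows "distr (unif n \<Otimes>\<^sub>M unif n) (Kborel absv \<Otimes>\<^sub>M Kborel absv)
      (\<lambda>(x1, x2). (a11 * x1 + a12 * x2, a21 * x1 + a22 * x2)) = unif n \<Otimes>\<^sub>M unif n"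
    (is "distr ?P ?B ?T = ?P")
proof (rule Kborel_pair_measure_eqI)
  interpret U: prob_space "unif n" by (rule prob_space_unif)
  interpret P: pair_prob_space "unif n" "unif n" ..
  have T [measurable]: "?T \<in> ?P \<rightarrow>\<^sub>M ?B" by simp
  show "prob_space ?P" by (rule P.prob_space_axioms)
  then show "prob_space (distr ?P ?B ?T)" by (rule prob_space.prob_space_distr) (rule T)
  show "sets ?P = sets ?B" by (intro sets_pair_measure_cong sets_unif)
  fix u v m
  obtain a b where ab: "a11 * a + a12 * b = u" "a21 * a + a22 * b = v"
    by (rule orthonormal2_surj[OF on])
  let ?r = "real q powi (max m n)" and ?c = "ennreal (real q powi (min m n)) / ennreal (real q powi n)"
  have *: "emeasure ?P (disc x m \<times> disc y m) = (if max (absv x) (absv y) \<le> ?r then ?c * ?c else 0)" for x y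
    by (simp add: U.emeasure_pair_measure_Times sets_unif emeasure_unif_disc)
  have "emeasure (distr ?P ?B ?T) (disc u m \<times> disc v m) = emeasure ?P (disc a m \<times> disc b m)"
    using vimage_square_disc[OF on, of a b m]
    by (subst emeasure_distr) (auto simp: ab space_pair_measure)
  \<comment> \<open>The centres \<open>(a, b)\<close> and \<open>(u, v)\<close> have equal norm, and
    the formula above sees nothing else of them.\<close>
  also have "\<dots> = emeasure ?P (disc u m \<times> disc v m)"
    unfolding * using orthonormal2_isometry[OF on, of a b] by (simp add: ab)
  finally show "emeasure (distr ?P ?B ?T) (disc u m \<times> disc v m) = emeasure ?P (disc u m \<times> disc v m)" .
qed simp

end

subsection \<open>Characteristic functions\<close>

locale local_field_char = local_field_haar absv q \<rho> lam
  for absv :: "'k::field \<Rightarrow> real" and q \<rho> lam +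
  fixes chr :: "'k \<Rightarrow> complex"
  assumes char: "is_character absv chr"
    and char_Dball: "chr ` Dball absv = {1}"
    and char_nontrivial: "chr ` ((\<lambda>x. inverse \<rho> * x) ` Dball absv) \<noteq> {1}"
begin

lemma char_add: "chr (x + y) = chr x * chr y"
  and norm_char [simp]: "norm (chr x) = 1"
  and char_continuous: "continuous_map (Ktop absv) euclidean chr"
  using char by (auto simp: is_character_def)

lemma char_eq_1: "absv x \<le> 1 \<Longrightarrow> chr x = 1"
  using char_Dball by (auto simp: Dball_def)

lemma char_measurable [measurable]: "chr \<in> borel_measurable (Kborel absv)"
proof (rule borel_measurableI)
  fix S :: "complex set" assume "open S"
  then have "openin (Ktop absv) {x \<in> topspace (Ktop absv). chr x \<in> S}"
    using char_continuous openin_continuous_map_preimage by fastforce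
  moreover have "topspace (Ktop absv) = UNIV"
    using Metric_space.topspace_mtopology[OF metric] by (simp add: Ktop_def)
  ultimately have "openin (Ktop absv) (chr -` S)"
    by (simp add: vimage_def)
  then show "chr -` S \<inter> space (Kborel absv) \<in> sets (Kborel absv)"
    by (auto simp: Kborel_def sets_measure_of_conv space_measure_of_conv intro: sigma_sets.Basic)
qed

lemma char_nontrivial_witness:
  obtains y where "absv y \<le> real q" "chr y \<noteq> 1"
proof -
  \<comment> \<open>Since the value 1 is attained at 0, an image different from \<open>{1}\<close>
    must contain a second value.\<close>
  have "1 \<in> chr ` ((\<lambda>x. inverse \<rho> * x) ` Dball absv)"
    by (rule image_eqI[of _ _ 0]) (auto simp: char_eq_1 Dball_def image_iff intro: exI[of _ 0])
  with char_nontrivial obtain x where x: "x \<in> Dball absv" "chr (inverse \<rho> * x) \<noteq> 1"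
    by blast
  have "absv (inverse \<rho> * x) = real q * absv x"
    by (simp add: absv_mult absv_inverse absv_uniformizer)
  also have "\<dots> \<le> real q" using x(1) by (simp add: Dball_def mult_left_le)
  finally show thesis using x(2) that by blast
qed

definition cf :: "'k measure \<Rightarrow> 'k \<Rightarrow> complex" where
  "cf \<mu> \<xi> = (\<integral>x. chr (\<xi> * x) \<partial>\<mu>)"

text \<open>On the dual disc the products \<open>\<xi> * x\<close> stay in \<open>D\<close>, where
  \<open>chr\<close> is 1. Off it, some translation preserving \<open>unif n\<close> multiplies the
  integral by a number other than 1.\<close>

lemma cf_unif: "cf (unif n) \<xi> = of_real (indicator (disc 0 (- n)) \<xi>)"
proof (cases "\<xi> \<in> disc 0 (- n)")
  case True
  interpret U: prob_space "unif n" by (rule prob_space_unif)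
  have "chr (\<xi> * x) = 1" if "x \<in> disc 0 n" for x
  proof (rule char_eq_1)
    have "absv (\<xi> * x) \<le> real q powi (- n) * real q powi n"
      unfolding absv_mult using True that by (intro mult_mono) (auto simp: disc_0)
    then show "absv (\<xi> * x) \<le> 1" by (simp flip: q_powi_add)
  qed
  moreover have "AE x in unif n. x \<in> disc 0 n"
    unfolding unif_def using q_gt_1 by (subst AE_uniform_measure) (auto simp: emeasure_disc)
  ultimately have "cf (unif n) \<xi> = (\<integral>x. 1 \<partial>unif n)"
    unfolding cf_def by (intro integral_cong_AE) auto
  with True show ?thesis by (simp add: U.prob_space[simplified])
next
  case False
  then have \<xi>: "real q powi (- n) < absv \<xi>" by (simp add: disc_0)
  then have nz: "\<xi> \<noteq> 0" by (metis absv_0 less_asym q_powi_pos)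
  then obtain k where k: "absv \<xi> = real q powi k" using absv_values by blast
  with \<xi> have kn: "1 - n \<le> k" by simp
  obtain y where y: "absv y \<le> real q" "chr y \<noteq> 1" by (rule char_nontrivial_witness)
  \<comment> \<open>Chosen so that \<open>\<xi> * b = y\<close>. It lies in \<open>disc 0 n\<close>
    because absolute values are discrete: \<open>absv \<xi>\<close> is at least \<open>q\<close> to
    the power \<open>1 - n\<close>.\<close>
  define b where "b = y / \<xi>"
  have "absv b = absv y * real q powi (- k)"
    by (simp add: b_def divide_inverse absv_mult absv_inverse k power_int_minus)
  also have "\<dots> \<le> real q powi 1 * real q powi (- k)"
    using y by (intro mult_right_mono) auto
  also have "\<dots> \<le> real q powi n"
    unfolding q_powi_add[symmetric] using kn by (subst q_powi_le_iff) simp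
  finally have b: "b \<in> disc 0 n" by (simp add: disc_0)
  have "cf (unif n) \<xi> = (\<integral>x. chr (\<xi> * x) \<partial>distr (unif n) (Kborel absv) ((+) b))"
    by (simp add: cf_def distr_translate_unif[OF b])
  also have "\<dots> = (\<integral>x. chr (\<xi> * (b + x)) \<partial>unif n)"
    by (rule integral_distr) auto
  also have "\<dots> = (\<integral>x. chr y * chr (\<xi> * x) \<partial>unif n)"
    using nz by (simp add: b_def distrib_left char_add)
  also have "\<dots> = chr y * cf (unif n) \<xi>"
    by (simp add: cf_def)
  finally have "cf (unif n) \<xi> = 0" using y(2) by simp
  with False show ?thesis by simp
qed

text \<open>Fourier inversion: averaging the characters \<open>x \<mapsto> chr (\<xi> * (x - a))\<close> over a disc of
  frequencies \<open>\<xi>\<close> gives the indicator function of the dual disc around \<open>a\<close>.\<close>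

lemma cf_inversion:
  assumes "prob_space \<mu>" and sets [measurable_cong]: "sets \<mu> = sets (Kborel absv)"
  shows "of_real (measure \<mu> (disc a (- m))) = (\<integral>\<xi>. chr (- (\<xi> * a)) * cf \<mu> \<xi> \<partial>unif m)"
proof -
  interpret \<mu>: prob_space \<mu> by fact
  interpret U: prob_space "unif m" by (rule prob_space_unif)
  interpret P: pair_prob_space \<mu> "unif m" ..
  have sp: "space \<mu> = UNIV" using sets_eq_imp_space_eq[OF sets] by simp
  have int: "integrable (\<mu> \<Otimes>\<^sub>M unif m) (\<lambda>(x, \<xi>). chr (\<xi> * (x + - a)))"
    by (rule P.integrable_const_bound[of _ 1]) (simp_all add: case_prod_unfold del: add_uminus_conv_diff)
  have "(\<integral>\<xi>. chr (- (\<xi> * a)) * cf \<mu> \<xi> \<partial>unif m) = (\<integral>\<xi>. (\<integral>x. chr (\<xi> * (x + - a)) \<partial>\<mu>) \<partial>unif m)"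
  proof (rule Bochner_Integration.integral_cong)
    fix \<xi>
    have "\<xi> * (x + - a) = - (\<xi> * a) + \<xi> * x" for x by (simp add: algebra_simps)
    then have "(\<integral>x. chr (\<xi> * (x + - a)) \<partial>\<mu>) = (\<integral>x. chr (- (\<xi> * a)) * chr (\<xi> * x) \<partial>\<mu>)"
      by (simp only: char_add)
    then show "chr (- (\<xi> * a)) * cf \<mu> \<xi> = (\<integral>x. chr (\<xi> * (x + - a)) \<partial>\<mu>)"
      by (simp add: cf_def)
  qed simp
  also have "\<dots> = (\<integral>x. (\<integral>\<xi>. chr (\<xi> * (x + - a)) \<partial>unif m) \<partial>\<mu>)"
    by (rule P.Fubini_integral[OF int])
  \<comment> \<open>Commutativity of the product exchanges the roles of frequency and
    variable.\<close>
  also have "\<dots> = (\<integral>x. cf (unif m) (x + - a) \<partial>\<mu>)"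
    by (simp only: cf_def mult.commute)
  also have "\<dots> = (\<integral>x. of_real (indicator (disc a (- m)) x) \<partial>\<mu>)"
    by (simp add: cf_unif disc_def indicator_def)
  also have "\<dots> = of_real (measure \<mu> (disc a (- m)))"
    by (simp add: integral_complex_of_real sp)
  finally show ?thesis by simp
qed

text \<open>Inversion recovers the mass of every disc, and these masses determine the
  measure.\<close>

lemma cf_unique:
  assumes "prob_space \<mu>" "prob_space \<nu>"
    and "sets \<mu> = sets (Kborel absv)" "sets \<nu> = sets (Kborel absv)"
    and "\<And>\<xi>. cf \<mu> \<xi> = cf \<nu> \<xi>"
  shows "\<mu> = \<nu>"
proof (rule Kborel_measure_eqI)
  fix a m
  interpret \<mu>: prob_space \<mu> by fact
  interpret \<nu>: prob_space \<nu> by fact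
  have "complex_of_real (measure \<mu> (disc a m)) = of_real (measure \<nu> (disc a m))"
    using cf_inversion[of \<mu> a "- m"] cf_inversion[of \<nu> a "- m"] assms by simp
  then show "emeasure \<mu> (disc a m) = emeasure \<nu> (disc a m)"
    by (simp add: \<mu>.emeasure_eq_measure \<nu>.emeasure_eq_measure)
qed fact+

lemma cf_eq_indicator_iff:
  assumes "prob_space \<mu>" "sets \<mu> = sets (Kborel absv)"
  shows "\<mu> = unif n \<longleftrightarrow> (\<forall>\<xi>. cf \<mu> \<xi> = of_real (indicator (disc 0 (- n)) \<xi>))"
  using cf_unique[OF assms(1) prob_space_unif assms(2) sets_unif] cf_unif by auto

text \<open>The point mass at 0 has this characteristic function. The lemma serves to exclude it by
  means of the assumption that \<open>X\<close> is not almost surely 0.\<close>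

lemma cf_trivial_imp_return:
  assumes "prob_space \<mu>" "sets \<mu> = sets (Kborel absv)" "\<And>\<xi>. cf \<mu> \<xi> = 1"
  shows "\<mu> = return (Kborel absv) 0"
proof (rule cf_unique)
  show "prob_space (return (Kborel absv) 0)" by (simp add: prob_space_return)
  show "cf \<mu> \<xi> = cf (return (Kborel absv) 0) \<xi>" for \<xi>
    using assms(3)[of \<xi>] by (simp add: cf_def[of "return _ _"] integral_return char_eq_1)
qed (use assms in auto)

text \<open>Only the first marginal of the invariance is used, together with independence. The
  coefficients 1 and 0 stay unsimplified so that \<open>inv\<close> matches an instance of
  \<open>K_gaussian\<close> literally.\<close>

lemma cf_shear:
  assumes "prob_space \<mu>" and sets [measurable_cong]: "sets \<mu> = sets (Kborel absv)"
    and inv: "distr (\<mu> \<Otimes>\<^sub>M \<mu>) (Kborel absv \<Otimes>\<^sub>M Kborel absv)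
        (\<lambda>(x1, x2). (1 * x1 + a * x2, 0 * x1 + 1 * x2))
        = \<mu> \<Otimes>\<^sub>M \<mu>"
  shows "cf \<mu> \<xi> = cf \<mu> \<xi> * cf \<mu> (a * \<xi>)"
proof -
  interpret \<mu>: prob_space \<mu> by fact
  interpret P: pair_prob_space \<mu> \<mu> ..
  have product: "(\<integral>z. chr (\<xi> * fst z) * chr (\<eta> * snd z) \<partial>(\<mu> \<Otimes>\<^sub>M \<mu>)) = cf \<mu> \<xi> * cf \<mu> \<eta>" for \<xi> \<eta>
  proof -
    have "integrable (\<mu> \<Otimes>\<^sub>M \<mu>) (\<lambda>z. chr (\<xi> * fst z) * chr (\<eta> * snd z))"
      by (rule P.integrable_const_bound[of _ 1]) (auto simp: norm_mult)
    from P.integral_fst'[OF this] show ?thesis by (simp add: cf_def)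
  qed
  \<comment> \<open>Frequency 0 in the second coordinate lifts \<open>cf \<mu> \<xi>\<close> to an
    integral over the product space.\<close>
  have "cf \<mu> \<xi> = (\<integral>z. chr (\<xi> * fst z) * chr (0 * snd z) \<partial>(\<mu> \<Otimes>\<^sub>M \<mu>))"
    unfolding product using \<mu>.prob_space by (simp add: cf_def char_eq_1)
  also have "\<dots> = (\<integral>z. chr (\<xi> * fst z) \<partial>(\<mu> \<Otimes>\<^sub>M \<mu>))"
    by (simp add: char_eq_1)
  also have "\<dots> = (\<integral>z. chr (\<xi> * fst z) \<partial>distr (\<mu> \<Otimes>\<^sub>M \<mu>) (Kborel absv \<Otimes>\<^sub>M Kborel absv)
      (\<lambda>(x1, x2). (1 * x1 + a * x2, 0 * x1 + 1 * x2)))"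
    by (simp only: inv)
  also have "\<dots> = (\<integral>z. chr (\<xi> * (fst z + a * snd z)) \<partial>(\<mu> \<Otimes>\<^sub>M \<mu>))"
    by (subst integral_distr) (auto simp: case_prod_unfold)
  also have "\<dots> = (\<integral>z. chr (\<xi> * fst z) * chr (a * \<xi> * snd z) \<partial>(\<mu> \<Otimes>\<^sub>M \<mu>))"
    by (simp add: distrib_left char_add ac_simps)
  also have "\<dots> = cf \<mu> \<xi> * cf \<mu> (a * \<xi>)" by (rule product)
  finally show ?thesis .
qed

text \<open>Powers of \<open>\<rho>\<close> tend to 0, so for fixed \<open>x\<close> the integrand
  is eventually 1. Dominated convergence gives the limit 1.\<close>

lemma cf_near_0:
  assumes "prob_space \<mu>" and sets [measurable_cong]: "sets \<mu> = sets (Kborel absv)"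
  shows "\<exists>k::nat. cf \<mu> (\<rho> ^ k) \<noteq> 0"
proof -
  interpret \<mu>: prob_space \<mu> by fact
  have "(\<lambda>k. cf \<mu> (\<rho> ^ k)) \<longlonglongrightarrow> (\<integral>x. 1 \<partial>\<mu>)"
    unfolding cf_def
  proof (rule integral_dominated_convergence[where w = "\<lambda>_. 1"])
    have "(\<lambda>k. chr (\<rho> ^ k * x)) \<longlonglongrightarrow> 1" for x
    proof (rule tendsto_eventually, rule eventually_sequentiallyI)
      fix k
      define n where "n = (SOME n. absv x \<le> real q powi int n)"
      have n: "absv x \<le> real q ^ n"
        unfolding n_def using ex_absv_le[of x] someI[of "\<lambda>n. absv x \<le> real q powi int n"] by auto
      \<comment> \<open>The threshold may depend on \<open>x\<close> but not on \<open>k\<close>,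
        hence a choice made from \<open>x\<close> alone.\<close>
      assume "(SOME n. absv x \<le> real q powi int n) \<le> k"
      then have "n \<le> k" by (simp add: n_def)
      have "absv (\<rho> ^ k * x) = absv x / real q ^ k"
        by (simp add: absv_mult absv_power absv_uniformizer power_one_over)
      also have "\<dots> \<le> 1"
        using order_trans[OF n power_increasing[OF \<open>n \<le> k\<close>, of "real q"]] q_gt_1
        by (simp add: divide_le_eq_1)
      finally show "chr (\<rho> ^ k * x) = 1" by (rule char_eq_1)
    qed
    then show "AE x in \<mu>. (\<lambda>k. chr (\<rho> ^ k * x)) \<longlonglongrightarrow> 1" by simp
  qed auto
  then have "(\<lambda>k. cf \<mu> (\<rho> ^ k)) \<longlonglongrightarrow> 1"
    using \<mu>.prob_space by simp
  then have "eventually (\<lambda>k. cf \<mu> (\<rho> ^ k) \<noteq> 0) sequentially"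
    by (rule tendsto_imp_eventually_ne) simp
  then show ?thesis by (auto simp: eventually_sequentially)
qed

lemma shear_invariant_eq_indicator:
  assumes near: "\<exists>k::nat. \<phi> (\<rho> ^ k) \<noteq> (0::complex)"
    and shear: "\<And>a \<xi>. absv a \<le> 1 \<Longrightarrow> \<phi> \<xi> = \<phi> \<xi> * \<phi> (a * \<xi>)"
    and nontrivial: "\<phi> \<xi>0 \<noteq> 1"
  obtains n where "\<And>\<xi>. \<phi> \<xi> = of_real (indicator (disc 0 (- n)) \<xi>)"
proof -
  have down: "\<phi> \<zeta> = 1" if "\<phi> \<xi> \<noteq> 0" "absv \<zeta> \<le> absv \<xi>" for \<xi> \<zeta>
  proof (cases "\<xi> = 0")
    case True
    have "absv \<zeta> \<le> 0" using that(2) unfolding True absv_0 .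
    then have "\<zeta> = 0" by (meson absv_pos_iff not_less)
    with True that(1) shear[of 0 \<xi>] show ?thesis by simp
  next
    case False
    have "absv (\<zeta> / \<xi>) = absv \<zeta> / absv \<xi>"
      by (simp add: divide_inverse absv_mult absv_inverse)
    also have "\<dots> \<le> 1" using that(2) False by (simp add: divide_le_eq_1)
    finally have "\<phi> \<xi> * 1 = \<phi> \<xi> * \<phi> (\<zeta> / \<xi> * \<xi>)"
      using shear[of "\<zeta> / \<xi>" \<xi>] by (simp only: mult_1_right)
    then show ?thesis using that(1) False by simp
  qed
  obtain k0 where k0: "\<phi> (\<rho> powi int k0) \<noteq> 0"
    using near by auto
  obtain j where j: "absv \<xi>0 \<le> real q powi int j" by (rule ex_absv_le)
  \<comment> \<open>For \<open>k\<close> at most \<open>- int j\<close> the disc of radius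
    \<open>absv (\<rho> powi k)\<close> contains \<open>\<xi>0\<close>, and \<open>down\<close>
    would force the value 1 there.\<close>
  have bounded: "- int j < k" if "\<phi> (\<rho> powi k) \<noteq> 0" for k
  proof (rule ccontr)
    assume "\<not> - int j < k"
    then have "absv \<xi>0 \<le> absv (\<rho> powi k)"
      using j order_trans[OF j, of "real q powi (- k)"] q_powi_le_iff[of "int j" "- k"]
      unfolding absv_uniformizer_powi by linarith
    with down[OF that] nontrivial show False by blast
  qed
  \<comment> \<open>The bound allows a shift by \<open>j\<close> to natural exponents, where a least
    one exists. It marks the largest disc on which \<open>\<phi>\<close> is 1.\<close>
  define N where "N = (LEAST i. \<phi> (\<rho> powi (int i - int j)) \<noteq> 0)"
  have ex: "\<phi> (\<rho> powi (int (k0 + j) - int j)) \<noteq> 0" using k0 by simp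
  define n where "n = int N - int j"
  have n: "\<phi> (\<rho> powi n) \<noteq> 0"
    unfolding n_def N_def by (rule LeastI[where P = "\<lambda>i. \<phi> (\<rho> powi (int i - int j)) \<noteq> 0", OF ex])
  \<comment> \<open>This keeps \<open>N - 1\<close> from being truncated, so the minimality of
    \<open>N\<close> gives a zero one exponent lower.\<close>
  have "N > 0" using bounded[OF n] by (simp add: n_def)
  then have "\<phi> (\<rho> powi (int (N - 1) - int j)) = 0"
    using not_less_Least[of "N - 1" "\<lambda>i. \<phi> (\<rho> powi (int i - int j)) \<noteq> 0"] unfolding N_def by simp
  then have n1: "\<phi> (\<rho> powi (n - 1)) = 0"
    using \<open>N > 0\<close> by (simp add: n_def of_nat_diff algebra_simps)
  have "\<phi> \<xi> = of_real (indicator (disc 0 (- n)) \<xi>)" for \<xi>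
  proof (cases "\<xi> \<in> disc 0 (- n)")
    case True
    with down[OF n, of \<xi>] show ?thesis by (simp add: disc_0 absv_uniformizer_powi)
  next
    case False
    then have *: "real q powi (- n) < absv \<xi>" by (simp add: disc_0)
    then have "\<xi> \<noteq> 0" by (metis absv_0 less_asym q_powi_pos)
    then obtain k where k: "absv \<xi> = real q powi k" using absv_values by blast
    \<comment> \<open>By discreteness a point outside the disc is at least as large as
      \<open>\<rho> powi (n - 1)\<close>; a nonzero value of \<open>\<phi>\<close> at it would make
      \<open>\<phi>\<close> equal to 1 at this zero.\<close>
    with * have "absv (\<rho> powi (n - 1)) \<le> absv \<xi>" by (simp add: absv_uniformizer_powi)
    with down[of \<xi> "\<rho> powi (n - 1)"] n1 have "\<phi> \<xi> = 0" by force
    with False show ?thesis by simp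
  qed
  then show thesis by (rule that)
qed

end

theorem theorem4p2:
  fixes absv :: "'k::field \<Rightarrow> real" and q :: nat and \<rho> :: 'k
    and lam :: "'k measure" and chr :: "'k \<Rightarrow> complex"
    and M :: "'b measure" and X :: "'b \<Rightarrow> 'k"
  assumes "local_field_data absv q \<rho>"
    and "normalized_haar absv lam"
    and "is_character absv chr"
    and "chr ` Dball absv = {1}"
    and "chr ` ((\<lambda>x. inverse \<rho> * x) ` Dball absv) \<noteq> {1}"
    and "prob_space M"
    and "X \<in> measurable M (Kborel absv)"
    and "\<not> (AE \<omega> in M. X \<omega> = 0)"
  shows "(K_gaussian absv M X \<longleftrightarrow>
           (\<exists>n::int. distr M (Kborel absv) X =
              density lam (\<lambda>x. ennreal (real q powr (- real_of_int n)
                                * Phi (real q powr (- real_of_int n) * absv x)))))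
       \<and> (\<forall>n::int. distr M (Kborel absv) X =
              density lam (\<lambda>x. ennreal (real q powr (- real_of_int n)
                                * Phi (real q powr (- real_of_int n) * absv x)))
            \<longleftrightarrow> (\<forall>\<xi>. integral\<^sup>L M (\<lambda>\<omega>. chr (\<xi> * X \<omega>))
                       = complex_of_real (Phi (real q powr (real_of_int n) * absv \<xi>))))"
proof -
  interpret local_field_char absv q \<rho> lam chr
    by unfold_locales fact+
  interpret M: prob_space M by fact
  note X [measurable] = \<open>X \<in> measurable M (Kborel absv)\<close>
  define \<mu> where "\<mu> = distr M (Kborel absv) X"
  have prob: "prob_space \<mu>" unfolding \<mu>_def by (rule M.prob_space_distr) simp
  have sets: "sets \<mu> = sets (Kborel absv)" by (simp add: \<mu>_def)
  have cf: "cf \<mu> \<xi> = (\<integral>\<omega>. chr (\<xi> * X \<omega>) \<partial>M)" for \<xi>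
    unfolding cf_def \<mu>_def by (rule integral_distr) auto
  \<comment> \<open>This identifies the function of \<open>\<xi>\<close> in the statement with the
    indicator of the dual disc that \<open>cf_unif\<close> yields.\<close>
  have Phi: "Phi (real q powr (real_of_int n) * absv \<xi>) = indicator (disc 0 (- n)) \<xi>" for n \<xi>
    using q_gt_1 powr_real_of_int'[of "real q" n]
    by (auto simp: Phi_def disc_0 indicator_def power_int_minus field_simps)
  have "K_gaussian absv M X \<longleftrightarrow> (\<exists>n. \<mu> = unif n)"
  proof
    assume G: "K_gaussian absv M X"
    have shear: "cf \<mu> \<xi> = cf \<mu> \<xi> * cf \<mu> (a * \<xi>)" if "absv a \<le> 1" for a \<xi>
      using G orthonormal2_shear[OF that] cf_shear[OF prob sets, of a \<xi>]
      unfolding K_gaussian_def Let_def \<mu>_def by blast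
    \<comment> \<open>The assumption that \<open>X\<close> is not almost surely 0 enters here: it
      supplies the frequency that bounds the disc.\<close>
    have "\<exists>\<xi>. cf \<mu> \<xi> \<noteq> 1"
    proof (rule ccontr)
      assume "\<nexists>\<xi>. cf \<mu> \<xi> \<noteq> 1"
      then have ret: "\<mu> = return (Kborel absv) 0"
        by (intro cf_trivial_imp_return prob sets) auto
      have zero: "{0} \<in> sets (Kborel absv)" by (rule singleton_in_sets)
      then have "Measurable.pred (Kborel absv) (\<lambda>x. x = 0)" by (simp add: pred_def)
      then have "AE x in \<mu>. x = 0" unfolding ret by (subst AE_return) auto
      then have "AE \<omega> in M. X \<omega> = 0"
        unfolding \<mu>_def using zero by (subst (asm) AE_distr_iff) auto
      with \<open>\<not> (AE \<omega> in M. X \<omega> = 0)\<close> show False by blast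
    qed
    then obtain \<xi>0 where "cf \<mu> \<xi>0 \<noteq> 1" by blast
    then obtain n where "\<And>\<xi>. cf \<mu> \<xi> = of_real (indicator (disc 0 (- n)) \<xi>)"
      using shear_invariant_eq_indicator[of "cf \<mu>", OF cf_near_0[OF prob sets] shear] by blast
    then show "\<exists>n. \<mu> = unif n" using cf_eq_indicator_iff[OF prob sets] by blast
  next
    assume "\<exists>n. \<mu> = unif n"
    then show "K_gaussian absv M X"
      using distr_unif_orthonormal2 unfolding K_gaussian_def Let_def \<mu>_def by auto
  qed
  moreover have "\<mu> = unif n \<longleftrightarrow> (\<forall>\<xi>. integral\<^sup>L M (\<lambda>\<omega>. chr (\<xi> * X \<omega>))
      = complex_of_real (Phi (real q powr (real_of_int n) * absv \<xi>)))" for n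
    by (simp add: cf_eq_indicator_iff[OF prob sets] cf Phi)
  ultimately show ?thesis
    unfolding density_eq_unif \<mu>_def by blast
qed

end
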